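(* Let $\boldsymbol{z}$ be a feasible solution of the full-scale model (FS) defined in the context. Let $\boldsymbol{\bar z}$ be derived from $\boldsymbol{z}$ by setting, for all $n\in\boldsymbol N$, $g\in\boldsymbol G$, $\omega\in\boldsymbol\Omega$, $r\in\boldsymbol R$, $$\bar e_{\omega,r} := \sum_{k\in\boldsymbol K_r}\frac{e_{\omega,k}}{K_r},\qquad \bar e^{\mathrm{ns}}_{\omega,r} := \sum_{k\in\boldsymbol K_r}\frac{e^{\mathrm{ns}}_{\omega,k}}{K_r},\qquad \bar e^{\mathrm s}_{n,\omega,r} := e^{\mathrm s}_{n,\omega,\min(\boldsymbol K_r)},$$ $$\bar p^{\mathrm{th}}_{g,\omega,r} := \sum_{k\in\boldsymbol K_r}\frac{p^{\mathrm{th}}_{g,\omega,k}}{K_r},\qquad \bar p^{\mathrm c}_{n,\omega,r} := \sum_{k\in\boldsymbol K_r}\frac{p^{\mathrm c}_{n,\omega,k}}{K_r},\qquad \bar p^{\mathrm d}_{n,\omega,r} := \sum_{k\in\boldsymbol K_r}\frac{p^{\mathrm d}_{n,\omega,k}}{K_r},$$ together with $\boldsymbol{\bar u}_0 := \boldsymbol u_0$. Then $\boldsymbol{\bar z}$ is a feasible solution of the temporally aggregated model (AGG) defined in the context, and $\bar F(\boldsymbol{\bar z})\le F(\boldsymbol z)$.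
   Context: **Index sets.** $\boldsymbol N$ (storage units, index $n$), $\boldsymbol G$ (thermal units, index $g$), $\boldsymbol\Omega$ (scenarios, index $\omega$) are finite sets. The prediction horizon is $\boldsymbol K=\{0,1,\dots,K-1\}$ (index $k$), with $K=|\boldsymbol K|$. The horizon is partitioned into $R$ nonempty clusters $\boldsymbol K_r$, $r\in\boldsymbol R=\{0,\dots,R-1\}$, with $K_r:=|\boldsymbol K_r|$. The clusters consist of consecutive time steps and are numbered chronologically, so that $\min(\boldsymbol K_0)=0$ and $\min(\boldsymbol K_{r+1})=\max(\boldsymbol K_r)+1$. The first and last time steps form singleton clusters: $\boldsymbol K_0=\{0\}$ and $\boldsymbol K_{R-1}=\{K-1\}$. **Parameters (all real).** - Sampling time $\Delta>0$; scenario probabilities $\phi_\omega\ge 0$ with $\sum_\omega\phi_\omega=1$. - Forecasts $P^{\mathrm{vRES}}_{\omega,k}$ (renewable generation), $D_{\omega,k}$ (demand), $\pi_{\omega,k}$ (price). - Storage: power limits $\overline P^{\mathrm c}_n,\overline P^{\mathrm d}_n$; efficiencies $\eta^{\mathrm c}_n,\eta^{\mathrm d}_n$; initial state $E^{\mathrm{s},0}_n$; state bounds $\underline E^{\mathrm s}_n,\overline E^{\mathrm s}_n$; reference state $E^{\mathrm{ref}}_n$; costs $C^{\mathrm c}_n,C^{\mathrm d}_n$; reference-deviation penalty $C^{\mathrm{ref}}_n\ge0$. - Thermal: output limits $\underline P^{\mathrm{th}}_g,\overline P^{\mathrm{th}}_g$; ramp limit $R^{\mathrm{th}}_g$; emission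 coefficients $\alpha_g\ge0$ and $\beta_g$; emission limit $L^{\mathrm{CO}_2}_g$; cost $C^{\mathrm{th}}_g$. - Non-supplied energy cost $C^{\mathrm{ns}}$. **Full-scale model (FS).** The variables are $$\boldsymbol z=\{\boldsymbol u_0,e_{\omega,k},e^{\mathrm{ns}}_{\omega,k},e^{\mathrm s}_{n,\omega,k},p^{\mathrm{th}}_{g,\omega,k},p^{\mathrm c}_{n,\omega,k},p^{\mathrm d}_{n,\omega,k}\}_{n,g,\omega,k},$$ where $\boldsymbol u_0=(u^{\mathrm{ns}},(u^{\mathrm{th}}_g)_{g},(u^{\mathrm c}_n)_n,(u^{\mathrm d}_n)_n)$ is the scenario-independent vector of first-step control actions. Minimize $$\begin{aligned}F(\boldsymbol z)=&\sum_{\omega}\phi_\omega\sum_{k\in\boldsymbol K}\left(-\pi_{\omega,k}e_{\omega,k}+C^{\mathrm{ns}}e^{\mathrm{ns}}_{\omega,k}\right)+\sum_\omega\phi_\omega\sum_{g}\sum_{k\in\boldsymbol K}C^{\mathrm{th}}_g p^{\mathrm{th}}_{g,\omega,k}\Delta\\&+\sum_\omega\phi_\omega\sum_n\sum_{k\in\boldsymbol K}\left(C^{\mathrm c}_n p^{\mathrm c}_{n,\omega,k}+C^{\mathrm d}_n p^{\mathrm d}_{n,\omega,k}\right)\Delta+\sum_\omega\phi_\omega\sum_n\sum_{k\in\boldsymbol K}C^{\mathrm{ref}}_n\left(e^{\mathrm s}_{n,\omega,k}-E^{\mathrm{ref}}_n\right)^2\end{aligned}$$ subject to, for all $n,g,\omega,k$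 (unless indicated otherwise): - $e_{\omega,k}=P^{\mathrm{vRES}}_{\omega,k}\Delta-D_{\omega,k}+\sum_n(p^{\mathrm d}_{n,\omega,k}-p^{\mathrm c}_{n,\omega,k})\Delta+\sum_g p^{\mathrm{th}}_{g,\omega,k}\Delta+e^{\mathrm{ns}}_{\omega,k}$; - $e^{\mathrm s}_{n,\omega,k+1}=e^{\mathrm s}_{n,\omega,k}+(\eta^{\mathrm c}_n p^{\mathrm c}_{n,\omega,k}-\eta^{\mathrm d}_n p^{\mathrm d}_{n,\omega,k})\Delta$ for $k\in\boldsymbol K\setminus\{K-1\}$; - $e^{\mathrm s}_{n,\omega,0}=E^{\mathrm{s},0}_n$; $\ \underline E^{\mathrm s}_n\le e^{\mathrm s}_{n,\omega,k}\le\overline E^{\mathrm s}_n$; - $0\le p^{\mathrm c}_{n,\omega,k}\le\overline P^{\mathrm c}_n$; $\ 0\le p^{\mathrm d}_{n,\omega,k}\le\overline P^{\mathrm d}_n$; $\ \underline P^{\mathrm{th}}_g\le p^{\mathrm{th}}_{g,\omega,k}\le\overline P^{\mathrm{th}}_g$; - $\alpha_g(p^{\mathrm{th}}_{g,\omega,k})^2+\beta_g p^{\mathrm{th}}_{g,\omega,k}\le L^{\mathrm{CO}_2}_g$; - $p^{\mathrm{th}}_{g,\omega,k+1}-p^{\mathrm{th}}_{g,\omega,k}\le R^{\mathrm{th}}_g$ and $p^{\mathrm{th}}_{g,\omega,k}-p^{\mathrm{th}}_{g,\omega,k+1}\le R^{\mathrm{th}}_g$ for $k\in\boldsymbol K\setminus\{K-1\}$;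 - (non-anticipativity) $e^{\mathrm{ns}}_{\omega,0}=u^{\mathrm{ns}}$, $p^{\mathrm{th}}_{g,\omega,0}=u^{\mathrm{th}}_g$, $p^{\mathrm c}_{n,\omega,0}=u^{\mathrm c}_n$, $p^{\mathrm d}_{n,\omega,0}=u^{\mathrm d}_n$; - $\boldsymbol z\ge\boldsymbol 0$ (all variables are nonnegative). **Temporally aggregated model (AGG).** The variables are $$\boldsymbol{\bar z}=\{\boldsymbol{\bar u}_0,\bar e_{\omega,r},\bar e^{\mathrm{ns}}_{\omega,r},\bar e^{\mathrm s}_{n,\omega,r},\bar p^{\mathrm{th}}_{g,\omega,r},\bar p^{\mathrm c}_{n,\omega,r},\bar p^{\mathrm d}_{n,\omega,r}\}_{n,g,\omega,r},$$ with $\boldsymbol{\bar u}_0=(\bar u^{\mathrm{ns}},(\bar u^{\mathrm{th}}_g)_g,(\bar u^{\mathrm c}_n)_n,(\bar u^{\mathrm d}_n)_n)$. Minimize $$\begin{aligned}\bar F(\boldsymbol{\bar z})=&\sum_\omega\phi_\omega\sum_{r\in\boldsymbol R}K_r\left(-\max_{k\in\boldsymbol K_r}\{\pi_{\omega,k}\}\,\bar e_{\omega,r}+C^{\mathrm{ns}}\bar e^{\mathrm{ns}}_{\omega,r}\right)+\sum_\omega\phi_\omega\sum_g\sum_{r\in\boldsymbol R}K_rC^{\mathrm{th}}_g\bar p^{\mathrm{th}}_{g,\omega,r}\Delta\\&+\sum_\omega\phi_\omega\sum_n\sum_{r\in\boldsymbol R}K_r\left(C^{\mathrm c}_n\bar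 p^{\mathrm c}_{n,\omega,r}+C^{\mathrm d}_n\bar p^{\mathrm d}_{n,\omega,r}\right)\Delta+\sum_\omega\phi_\omega\sum_n\sum_{r\in\boldsymbol R}C^{\mathrm{ref}}_n\left(\bar e^{\mathrm s}_{n,\omega,r}-E^{\mathrm{ref}}_n\right)^2\end{aligned}$$ subject to, for all $n,g,\omega,r$ (unless indicated otherwise): - $\bar e_{\omega,r}=\sum_{k\in\boldsymbol K_r}\frac{P^{\mathrm{vRES}}_{\omega,k}\Delta-D_{\omega,k}}{K_r}+\sum_g\bar p^{\mathrm{th}}_{g,\omega,r}\Delta+\bar e^{\mathrm{ns}}_{\omega,r}+\sum_n(\bar p^{\mathrm d}_{n,\omega,r}-\bar p^{\mathrm c}_{n,\omega,r})\Delta$; - $\bar e^{\mathrm s}_{n,\omega,r+1}=\bar e^{\mathrm s}_{n,\omega,r}+K_r(\eta^{\mathrm c}_n\bar p^{\mathrm c}_{n,\omega,r}-\eta^{\mathrm d}_n\bar p^{\mathrm d}_{n,\omega,r})\Delta$ for $r\in\boldsymbol R\setminus\{R-1\}$; - $\bar e^{\mathrm s}_{n,\omega,0}=E^{\mathrm{s},0}_n$; $\ \underline E^{\mathrm s}_n\le\bar e^{\mathrm s}_{n,\omega,r}\le\overline E^{\mathrm s}_n$; - $0\le\bar p^{\mathrm c}_{n,\omega,r}\le\overline P^{\mathrm c}_n$; $\ 0\le\bar p^{\mathrm d}_{n,\omega,r}\le\overline P^{\mathrm d}_n$; $\ \underline P^{\mathrm{th}}_g\le\bar p^{\mathrm{th}}_{g,\omega,r}\le\overline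 P^{\mathrm{th}}_g$; - $\alpha_gK_r(\bar p^{\mathrm{th}}_{g,\omega,r})^2-\alpha_g(K_r-1)(\overline P^{\mathrm{th}}_g)^2+\beta_g\bar p^{\mathrm{th}}_{g,\omega,r}\le L^{\mathrm{CO}_2}_g$; - $\bar p^{\mathrm{th}}_{g,\omega,r+1}-\bar p^{\mathrm{th}}_{g,\omega,r}K_r\le R^{\mathrm{th}}_g+R^{\mathrm{th}}_g\frac{K_{r+1}-1}{2}$ for $r\in\boldsymbol R\setminus\{R-1\}$; - $\bar p^{\mathrm{th}}_{g,\omega,r}-\bar p^{\mathrm{th}}_{g,\omega,r+1}K_{r+1}\le R^{\mathrm{th}}_g+R^{\mathrm{th}}_g\frac{K_r-1}{2}$ for $r\in\boldsymbol R\setminus\{R-1\}$; - (non-anticipativity) $\bar e^{\mathrm{ns}}_{\omega,0}=\bar u^{\mathrm{ns}}$, $\bar p^{\mathrm{th}}_{g,\omega,0}=\bar u^{\mathrm{th}}_g$, $\bar p^{\mathrm c}_{n,\omega,0}=\bar u^{\mathrm c}_n$, $\bar p^{\mathrm d}_{n,\omega,0}=\bar u^{\mathrm d}_n$; - $\boldsymbol{\bar z}\ge\boldsymbol 0$ (all variables are nonnegative). A feasible solution of either model is an assignment of real values to its variables satisfying all its constraints. *)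

theory Defs
  imports Complex_Main "HOL-Library.Disjoint_Sets"
begin

text \<open>
  Parameters carry explicit index sets; values of parameter and variable functions outside these
  sets are irrelevant. Time steps and clusters are numbered from 0, so the time steps are
  \<open>{..<horizon P}\<close> and the cluster numbers are \<open>{..<nclusters P}\<close>.
\<close>

record ('n, 'g, 'w) params =
  storage :: "'n set"
  thermal :: "'g set"
  scenarios :: "'w set"
  horizon :: nat
  nclusters :: nat
  cluster :: "nat \<Rightarrow> nat set"
  step_len :: real                         \<comment> \<open>\<open>\<Delta>\<close>\<close>
  prob :: "'w \<Rightarrow> real"                     \<comment> \<open>\<open>\<phi>\<close>\<close>
  P_vres :: "'w \<Rightarrow> nat \<Rightarrow> real"
  demand :: "'w \<Rightarrow> nat \<Rightarrow> real"
  price :: "'w \<Rightarrow> nat \<Rightarrow> real"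
  P_ch_max :: "'n \<Rightarrow> real"
  P_dis_max :: "'n \<Rightarrow> real"
  eff_ch :: "'n \<Rightarrow> real"
  eff_dis :: "'n \<Rightarrow> real"
  E_init :: "'n \<Rightarrow> real"
  E_min :: "'n \<Rightarrow> real"
  E_max :: "'n \<Rightarrow> real"
  E_ref :: "'n \<Rightarrow> real"
  C_ch :: "'n \<Rightarrow> real"
  C_dis :: "'n \<Rightarrow> real"
  C_ref :: "'n \<Rightarrow> real"
  P_th_min :: "'g \<Rightarrow> real"
  P_th_max :: "'g \<Rightarrow> real"
  ramp :: "'g \<Rightarrow> real"
  em_quad :: "'g \<Rightarrow> real"                  \<comment> \<open>\<open>\<alpha>\<close>\<close>
  em_lin :: "'g \<Rightarrow> real"                   \<comment> \<open>\<open>\<beta>\<close>\<close>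
  em_limit :: "'g \<Rightarrow> real"
  C_th :: "'g \<Rightarrow> real"
  C_ns :: real

text \<open>
  Both models have the same variables, except that the last index is a time step in the full-scale
  model and a cluster number in the aggregated model. The fields \<open>u_*\<close> form the first-step control
  vector.
\<close>

record ('n, 'g, 'w) vars =
  u_ns :: real
  u_th :: "'g \<Rightarrow> real"
  u_ch :: "'n \<Rightarrow> real"
  u_dis :: "'n \<Rightarrow> real"
  e_net :: "'w \<Rightarrow> nat \<Rightarrow> real"
  e_ns :: "'w \<Rightarrow> nat \<Rightarrow> real"
  e_st :: "'n \<Rightarrow> 'w \<Rightarrow> nat \<Rightarrow> real"
  p_th :: "'g \<Rightarrow> 'w \<Rightarrow> nat \<Rightarrow> real"
  p_ch :: "'n \<Rightarrow> 'w \<Rightarrow> nat \<Rightarrow> real"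
  p_dis :: "'n \<Rightarrow> 'w \<Rightarrow> nat \<Rightarrow> real"

definition valid_clustering :: "('n, 'g, 'w) params \<Rightarrow> bool" where
  "valid_clustering P \<longleftrightarrow>
     0 < nclusters P \<and>
     (\<Union>r<nclusters P. cluster P r) = {..<horizon P} \<and>
     disjoint_family_on (cluster P) {..<nclusters P} \<and>
     (\<forall>r<nclusters P. cluster P r \<noteq> {}) \<and>
     (\<forall>r<nclusters P. cluster P r = {Min (cluster P r)..Max (cluster P r)}) \<and>
     Min (cluster P 0) = 0 \<and>
     (\<forall>r. r + 1 < nclusters P \<longrightarrow> Min (cluster P (r + 1)) = Max (cluster P r) + 1) \<and>
     cluster P 0 = {0} \<and>
     cluster P (nclusters P - 1) = {horizon P - 1}"

definition valid_params :: "('n, 'g, 'w) params \<Rightarrow> bool" where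
  "valid_params P \<longleftrightarrow>
     finite (storage P) \<and> finite (thermal P) \<and> finite (scenarios P) \<and>
     valid_clustering P \<and>
     0 < step_len P \<and>
     (\<forall>w\<in>scenarios P. 0 \<le> prob P w) \<and> (\<Sum>w\<in>scenarios P. prob P w) = 1 \<and>
     (\<forall>n\<in>storage P. 0 \<le> C_ref P n) \<and>
     (\<forall>g\<in>thermal P. 0 \<le> em_quad P g)"

text \<open>Nonnegativity of all variables whose last index ranges over \<open>{..<T}\<close>.\<close>

definition nonneg_vars :: "('n, 'g, 'w) params \<Rightarrow> nat \<Rightarrow> ('n, 'g, 'w) vars \<Rightarrow> bool" where
  "nonneg_vars P T z \<longleftrightarrow>
     0 \<le> u_ns z \<and> (\<forall>g\<in>thermal P. 0 \<le> u_th z g) \<and>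
     (\<forall>n\<in>storage P. 0 \<le> u_ch z n \<and> 0 \<le> u_dis z n) \<and>
     (\<forall>w\<in>scenarios P. \<forall>t<T.
        0 \<le> e_net z w t \<and> 0 \<le> e_ns z w t \<and>
        (\<forall>g\<in>thermal P. 0 \<le> p_th z g w t) \<and>
        (\<forall>n\<in>storage P. 0 \<le> e_st z n w t \<and> 0 \<le> p_ch z n w t \<and> 0 \<le> p_dis z n w t))"

definition nonanticipative :: "('n, 'g, 'w) params \<Rightarrow> ('n, 'g, 'w) vars \<Rightarrow> bool" where
  "nonanticipative P z \<longleftrightarrow>
     (\<forall>w\<in>scenarios P.
        e_ns z w 0 = u_ns z \<and>
        (\<forall>g\<in>thermal P. p_th z g w 0 = u_th z g) \<and>
        (\<forall>n\<in>storage P. p_ch z n w 0 = u_ch z n \<and> p_dis z n w 0 = u_dis z n))"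

definition FS_feasible :: "('n, 'g, 'w) params \<Rightarrow> ('n, 'g, 'w) vars \<Rightarrow> bool" where
  "FS_feasible P z \<longleftrightarrow>
     (\<forall>w\<in>scenarios P. \<forall>k<horizon P.
        e_net z w k = P_vres P w k * step_len P - demand P w k
          + (\<Sum>n\<in>storage P. (p_dis z n w k - p_ch z n w k) * step_len P)
          + (\<Sum>g\<in>thermal P. p_th z g w k * step_len P) + e_ns z w k) \<and>
     (\<forall>n\<in>storage P. \<forall>w\<in>scenarios P. \<forall>k. k + 1 < horizon P \<longrightarrow>
        e_st z n w (k + 1) = e_st z n w k
          + (eff_ch P n * p_ch z n w k - eff_dis P n * p_dis z n w k) * step_len P) \<and>
     (\<forall>n\<in>storage P. \<forall>w\<in>scenarios P. e_st z n w 0 = E_init P n) \<and>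
     (\<forall>n\<in>storage P. \<forall>w\<in>scenarios P. \<forall>k<horizon P.
        E_min P n \<le> e_st z n w k \<and> e_st z n w k \<le> E_max P n \<and>
        0 \<le> p_ch z n w k \<and> p_ch z n w k \<le> P_ch_max P n \<and>
        0 \<le> p_dis z n w k \<and> p_dis z n w k \<le> P_dis_max P n) \<and>
     (\<forall>g\<in>thermal P. \<forall>w\<in>scenarios P. \<forall>k<horizon P.
        P_th_min P g \<le> p_th z g w k \<and> p_th z g w k \<le> P_th_max P g \<and>
        em_quad P g * (p_th z g w k)\<^sup>2 + em_lin P g * p_th z g w k \<le> em_limit P g) \<and>
     (\<forall>g\<in>thermal P. \<forall>w\<in>scenarios P. \<forall>k. k + 1 < horizon P \<longrightarrow>
        p_th z g w (k + 1) - p_th z g w k \<le> ramp P g \<and>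
        p_th z g w k - p_th z g w (k + 1) \<le> ramp P g) \<and>
     nonanticipative P z \<and>
     nonneg_vars P (horizon P) z"

definition FS_cost :: "('n, 'g, 'w) params \<Rightarrow> ('n, 'g, 'w) vars \<Rightarrow> real" where
  "FS_cost P z =
     (\<Sum>w\<in>scenarios P. prob P w *
        (\<Sum>k<horizon P. - price P w k * e_net z w k + C_ns P * e_ns z w k))
   + (\<Sum>w\<in>scenarios P. prob P w *
        (\<Sum>g\<in>thermal P. \<Sum>k<horizon P. C_th P g * p_th z g w k * step_len P))
   + (\<Sum>w\<in>scenarios P. prob P w *
        (\<Sum>n\<in>storage P. \<Sum>k<horizon P.
           (C_ch P n * p_ch z n w k + C_dis P n * p_dis z n w k) * step_len P))
   + (\<Sum>w\<in>scenarios P. prob P w *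
        (\<Sum>n\<in>storage P. \<Sum>k<horizon P. C_ref P n * (e_st z n w k - E_ref P n)\<^sup>2))"

abbreviation csize :: "('n, 'g, 'w) params \<Rightarrow> nat \<Rightarrow> real" where
  "csize P r \<equiv> real (card (cluster P r))"

definition AGG_feasible :: "('n, 'g, 'w) params \<Rightarrow> ('n, 'g, 'w) vars \<Rightarrow> bool" where
  "AGG_feasible P z \<longleftrightarrow>
     (\<forall>w\<in>scenarios P. \<forall>r<nclusters P.
        e_net z w r = (\<Sum>k\<in>cluster P r. (P_vres P w k * step_len P - demand P w k) / csize P r)
          + (\<Sum>g\<in>thermal P. p_th z g w r * step_len P) + e_ns z w r
          + (\<Sum>n\<in>storage P. (p_dis z n w r - p_ch z n w r) * step_len P)) \<and>
     (\<forall>n\<in>storage P. \<forall>w\<in>scenarios P. \<forall>r. r + 1 < nclusters P \<longrightarrow>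
        e_st z n w (r + 1) = e_st z n w r
          + csize P r * (eff_ch P n * p_ch z n w r - eff_dis P n * p_dis z n w r) * step_len P) \<and>
     (\<forall>n\<in>storage P. \<forall>w\<in>scenarios P. e_st z n w 0 = E_init P n) \<and>
     (\<forall>n\<in>storage P. \<forall>w\<in>scenarios P. \<forall>r<nclusters P.
        E_min P n \<le> e_st z n w r \<and> e_st z n w r \<le> E_max P n \<and>
        0 \<le> p_ch z n w r \<and> p_ch z n w r \<le> P_ch_max P n \<and>
        0 \<le> p_dis z n w r \<and> p_dis z n w r \<le> P_dis_max P n) \<and>
     (\<forall>g\<in>thermal P. \<forall>w\<in>scenarios P. \<forall>r<nclusters P.
        P_th_min P g \<le> p_th z g w r \<and> p_th z g w r \<le> P_th_max P g \<and>
        em_quad P g * csize P r * (p_th z g w r)\<^sup>2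
          - em_quad P g * (csize P r - 1) * (P_th_max P g)\<^sup>2
          + em_lin P g * p_th z g w r \<le> em_limit P g) \<and>
     (\<forall>g\<in>thermal P. \<forall>w\<in>scenarios P. \<forall>r. r + 1 < nclusters P \<longrightarrow>
        p_th z g w (r + 1) - p_th z g w r * csize P r
          \<le> ramp P g + ramp P g * ((csize P (r + 1) - 1) / 2) \<and>
        p_th z g w r - p_th z g w (r + 1) * csize P (r + 1)
          \<le> ramp P g + ramp P g * ((csize P r - 1) / 2)) \<and>
     nonanticipative P z \<and>
     nonneg_vars P (nclusters P) z"

definition AGG_cost :: "('n, 'g, 'w) params \<Rightarrow> ('n, 'g, 'w) vars \<Rightarrow> real" where
  "AGG_cost P z =
     (\<Sum>w\<in>scenarios P. prob P w *
        (\<Sum>r<nclusters P. csize P r *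
           (- (MAX k\<in>cluster P r. price P w k) * e_net z w r + C_ns P * e_ns z w r)))
   + (\<Sum>w\<in>scenarios P. prob P w *
        (\<Sum>g\<in>thermal P. \<Sum>r<nclusters P. csize P r * C_th P g * p_th z g w r * step_len P))
   + (\<Sum>w\<in>scenarios P. prob P w *
        (\<Sum>n\<in>storage P. \<Sum>r<nclusters P.
           csize P r * (C_ch P n * p_ch z n w r + C_dis P n * p_dis z n w r) * step_len P))
   + (\<Sum>w\<in>scenarios P. prob P w *
        (\<Sum>n\<in>storage P. \<Sum>r<nclusters P. C_ref P n * (e_st z n w r - E_ref P n)\<^sup>2))"

definition aggregate :: "('n, 'g, 'w) params \<Rightarrow> ('n, 'g, 'w) vars \<Rightarrow> ('n, 'g, 'w) vars" where
  "aggregate P z =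
     \<lparr> u_ns = u_ns z, u_th = u_th z, u_ch = u_ch z, u_dis = u_dis z,
       e_net = (\<lambda>w r. \<Sum>k\<in>cluster P r. e_net z w k / csize P r),
       e_ns = (\<lambda>w r. \<Sum>k\<in>cluster P r. e_ns z w k / csize P r),
       e_st = (\<lambda>n w r. e_st z n w (Min (cluster P r))),
       p_th = (\<lambda>g w r. \<Sum>k\<in>cluster P r. p_th z g w k / csize P r),
       p_ch = (\<lambda>n w r. \<Sum>k\<in>cluster P r. p_ch z n w k / csize P r),
       p_dis = (\<lambda>n w r. \<Sum>k\<in>cluster P r. p_dis z n w k / csize P r) \<rparr>"

end

theory Submission
  imports Defs
begin

text \<open>
  Within one cluster every aggregated variable except the storage state is the mean of the
  full-scale variable. Means commute with the linear constraints and stay inside every interval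
  that contains the averaged values, so the energy balance, the bounds and the linear cost terms
  carry over. The remaining parts each rest on one observation.

  \<^item> Storage: a cluster of \<open>c\<close> steps contributes \<open>c\<close> times the mean increment, so the recursion
    between the first steps of two neighbouring clusters is a telescoped sum
    (\<open>telescope_by_mean\<close>).
  \<^item> Emissions: the square of a mean is at most the mean of the squares, which turns the
    constraints of the single steps into one for the mean. The aggregated constraint has \<open>c - 1\<close>
    further copies of the squared mean, and these are compensated by \<open>c - 1\<close> copies of the
    squared output limit (\<open>emission_of_mean\<close>).
  \<^item> Ramping: every step of a cluster is reached from the adjacent step \<open>q\<close> of the neighbouring
    cluster by \<open>1, ..., c\<close> ramps. On average this is \<open>1 + (c - 1) / 2\<close> ramps; and the output at
    \<open>q\<close> is at most the total output of the neighbouring cluster, as outputs are nonnegative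
    (\<open>ramp_up_mean\<close>, \<open>ramp_down_mean\<close>).
  \<^item> Cost: replacing prices by their maximum over the cluster can only lower the cost, because
    sold energy is nonnegative. The aggregated reference penalty of a cluster is that of its first
    step alone, one of the nonnegative penalties of its steps.
\<close>

section \<open>Means over finite sets\<close>

abbreviation mean :: "'a set \<Rightarrow> ('a \<Rightarrow> real) \<Rightarrow> real" where
  "mean A f \<equiv> \<Sum>k\<in>A. f k / real (card A)"

lemma card_times_mean:
  assumes "finite A" "A \<noteq> {}"
  shows "real (card A) * mean A f = sum f A"
  using assms by (simp add: sum_distrib_left)

lemma mean_const:
  assumes "finite A" "A \<noteq> {}"
  shows "mean A (\<lambda>_. c) = c"
  using assms by simp

lemma mean_mono:
  assumes "\<And>k. k \<in> A \<Longrightarrow> f k \<le> g k"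
  shows "mean A f \<le> mean A g"
  using assms by (intro sum_mono divide_right_mono) auto

lemma mean_le:
  assumes "finite A" "A \<noteq> {}" "\<And>k. k \<in> A \<Longrightarrow> f k \<le> c"
  shows "mean A f \<le> c"
  using mean_mono[of A f "\<lambda>_. c"] mean_const[OF assms(1,2), of c] assms(3) by simp

lemma le_mean:
  assumes "finite A" "A \<noteq> {}" "\<And>k. k \<in> A \<Longrightarrow> c \<le> f k"
  shows "c \<le> mean A f"
  using mean_mono[of A "\<lambda>_. c" f] mean_const[OF assms(1,2), of c] assms(3) by simp

lemma mean_add: "mean A (\<lambda>k. f k + g k) = mean A f + mean A g"
  by (simp add: add_divide_distrib sum.distrib)

lemma mean_diff: "mean A (\<lambda>k. f k - g k) = mean A f - mean A g"
  by (simp add: diff_divide_distrib sum_subtractf)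

lemma mean_mult_left: "mean A (\<lambda>k. c * f k) = c * mean A f"
  by (simp add: sum_distrib_left)

lemma mean_mult_right: "mean A (\<lambda>k. f k * c) = mean A f * c"
  by (simp add: sum_distrib_right)

lemma mean_sum: "mean A (\<lambda>k. \<Sum>i\<in>I. f i k) = (\<Sum>i\<in>I. mean A (f i))"
  unfolding sum_divide_distrib by (rule sum.swap)

lemmas mean_linear = mean_add mean_diff mean_mult_left mean_mult_right mean_sum

lemma power2_mean_le:
  assumes "finite A" "A \<noteq> {}"
  shows "(mean A f)\<^sup>2 \<le> mean A (\<lambda>k. (f k)\<^sup>2)"
proof -
  \<comment> \<open>The parabola lies above its tangent at the mean; the tangent commutes with the mean.\<close>
  define m where "m = mean A f"
  have tangent: "2 * m * f k - m\<^sup>2 \<le> (f k)\<^sup>2" for k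
    using zero_le_power2[of "f k - m"] by (simp add: power2_diff algebra_simps)
  have "m\<^sup>2 = 2 * m * m - m\<^sup>2"
    by (simp add: power2_eq_square)
  also have "\<dots> = mean A (\<lambda>k. 2 * m * f k - m\<^sup>2)"
    unfolding mean_diff mean_mult_left mean_const[OF assms] by (simp add: m_def)
  also have "\<dots> \<le> mean A (\<lambda>k. (f k)\<^sup>2)"
    using tangent by (rule mean_mono)
  finally show ?thesis
    by (simp add: m_def)
qed

text \<open>
  Convexity gives the aggregated emission constraint with coefficient \<open>a\<close> instead of \<open>a * c\<close>, where
  \<open>c = card A\<close>. The other \<open>c - 1\<close> squares of the mean are each bounded by \<open>u\<^sup>2\<close>.
\<close>
lemma emission_of_mean:
  assumes A: "finite A" "A \<noteq> {}" and "0 \<le> a"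
    and range: "\<And>k. k \<in> A \<Longrightarrow> 0 \<le> f k \<and> f k \<le> u"
    and lim: "\<And>k. k \<in> A \<Longrightarrow> a * (f k)\<^sup>2 + b * f k \<le> l"
  shows "a * real (card A) * (mean A f)\<^sup>2 - a * (real (card A) - 1) * u\<^sup>2 + b * mean A f \<le> l"
proof -
  let ?m = "mean A f"
  have "a * ?m\<^sup>2 + b * ?m \<le> a * mean A (\<lambda>k. (f k)\<^sup>2) + b * ?m"
    using power2_mean_le[OF A, of f] \<open>0 \<le> a\<close> by (intro add_right_mono mult_left_mono)
  also have "\<dots> = mean A (\<lambda>k. a * (f k)\<^sup>2 + b * f k)"
    by (simp only: mean_linear)
  also have "\<dots> \<le> l"
    using A lim by (rule mean_le)
  finally have convexity: "a * ?m\<^sup>2 + b * ?m \<le> l" .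
  have "0 \<le> ?m" "?m \<le> u"
    using le_mean[OF A, of 0 f] mean_le[OF A, of f u] range by simp_all
  then have "?m\<^sup>2 \<le> u\<^sup>2"
    by (simp add: power_mono)
  moreover have "1 \<le> real (card A)"
    using A by (simp add: Suc_leI card_gt_0_iff)
  ultimately have "a * (real (card A) - 1) * ?m\<^sup>2 \<le> a * (real (card A) - 1) * u\<^sup>2"
    using \<open>0 \<le> a\<close> by (intro mult_left_mono) simp_all
  with convexity show ?thesis
    by (simp add: algebra_simps)
qed

section \<open>Sequences on intervals of time steps\<close>

lemma telescope_by_mean:
  fixes s d :: "nat \<Rightarrow> real"
  assumes "a \<le> b" and step: "\<And>k. k \<in> {a..b} \<Longrightarrow> s (k + 1) = s k + d k"
  shows "s (b + 1) = s a + real (card {a..b}) * mean {a..b} d"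
proof -
  have "s (b + 1) - s a = (\<Sum>k=a..b. s (Suc k) - s k)"
    using \<open>a \<le> b\<close> by (simp add: sum_Suc_diff)
  also have "\<dots> = sum d {a..b}"
    using step by (intro sum.cong) auto
  also have "\<dots> = real (card {a..b}) * mean {a..b} d"
    using \<open>a \<le> b\<close> by (intro card_times_mean[symmetric]) auto
  finally show ?thesis
    by simp
qed

lemma mean_distance_left:
  assumes "a \<le> b"
  shows "mean {a..b} (\<lambda>k. real (k - a)) = (real (card {a..b}) - 1) / 2"
proof -
  have "2 * (\<Sum>k=a..b. real (k - a)) = real (card {a..b}) * (real (card {a..b}) - 1)"
    using assms by (induction b rule: dec_induct) (auto simp: algebra_simps of_nat_diff)
  then show ?thesis
    using assms by (simp add: sum_divide_distrib[symmetric] field_simps)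
qed

lemma mean_distance_right:
  assumes "a \<le> b"
  shows "mean {a..b} (\<lambda>k. real (b - k)) = (real (card {a..b}) - 1) / 2"
proof -
  have "mean {a..b} (\<lambda>k. real (b - k)) = mean {a..b} (\<lambda>k. real (k - a))"
    by (rule sum.reindex_bij_witness[of _ "\<lambda>k. a + b - k" "\<lambda>k. a + b - k"]) auto
  then show ?thesis
    using mean_distance_left[OF assms] by simp
qed

lemma bounded_increments:
  fixes p :: "nat \<Rightarrow> real"
  assumes "i \<le> k" and "\<And>j. i \<le> j \<Longrightarrow> j < k \<Longrightarrow> p (j + 1) - p j \<le> \<rho>"
  shows "p k \<le> p i + \<rho> * real (k - i)"
  using assms
proof (induction k rule: dec_induct)
  case base
  then show ?case by simp
next
  case (step k)
  have "p k \<le> p i + \<rho> * real (k - i)"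
    using step by simp
  moreover have "p (Suc k) - p k \<le> \<rho>"
    using step by force
  ultimately show ?case
    using \<open>i \<le> k\<close> by (simp add: Suc_diff_le algebra_simps)
qed

text \<open>
  Step \<open>k\<close> of the later cluster \<open>{b + 1..c}\<close> is \<open>1 + (k - (b + 1))\<close> ramps away from the last step
  \<open>b\<close> of the earlier one.
\<close>
lemma ramp_up_mean:
  fixes p :: "nat \<Rightarrow> real"
  assumes "a \<le> b" "b < c"
    and nonneg: "\<And>k. k \<in> {a..b} \<Longrightarrow> 0 \<le> p k"
    and ramp: "\<And>k. b \<le> k \<Longrightarrow> k < c \<Longrightarrow> p (k + 1) - p k \<le> \<rho>"
  shows "mean {b + 1..c} p - mean {a..b} p * real (card {a..b})
           \<le> \<rho> + \<rho> * ((real (card {b + 1..c}) - 1) / 2)"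
proof -
  let ?A = "{b + 1..c}"
  have A: "finite ?A" "?A \<noteq> {}"
    using \<open>b < c\<close> by auto
  have "p k \<le> (p b + \<rho>) + \<rho> * real (k - (b + 1))" if "k \<in> ?A" for k
    using bounded_increments[of b k p \<rho>] ramp that by (simp add: of_nat_diff algebra_simps)
  then have "mean ?A p \<le> mean ?A (\<lambda>k. (p b + \<rho>) + \<rho> * real (k - (b + 1)))"
    by (rule mean_mono)
  also have "\<dots> = p b + \<rho> + \<rho> * ((real (card ?A) - 1) / 2)"
    unfolding mean_add mean_mult_left mean_const[OF A]
    using \<open>b < c\<close> by (subst mean_distance_left) auto
  also have "p b \<le> sum p {a..b}"
    using \<open>a \<le> b\<close> nonneg by (intro member_le_sum) auto
  also have "sum p {a..b} = mean {a..b} p * real (card {a..b})"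
    using card_times_mean[of "{a..b}" p] \<open>a \<le> b\<close> by (simp add: mult.commute)
  finally show ?thesis
    by simp
qed

text \<open>
  The time-reversed situation: step \<open>k\<close> of the earlier cluster \<open>{a..b}\<close> is \<open>1 + (b - k)\<close> ramps
  away from the first step \<open>b + 1\<close> of the later one.
\<close>
lemma ramp_down_mean:
  fixes p :: "nat \<Rightarrow> real"
  assumes "a \<le> b" "b < c"
    and nonneg: "\<And>k. k \<in> {b + 1..c} \<Longrightarrow> 0 \<le> p k"
    and ramp: "\<And>k. a \<le> k \<Longrightarrow> k \<le> b \<Longrightarrow> p k - p (k + 1) \<le> \<rho>"
  shows "mean {a..b} p - mean {b + 1..c} p * real (card {b + 1..c})
           \<le> \<rho> + \<rho> * ((real (card {a..b}) - 1) / 2)"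
proof -
  let ?A = "{a..b}"
  have A: "finite ?A" "?A \<noteq> {}"
    using \<open>a \<le> b\<close> by auto
  have "p k \<le> (p (b + 1) + \<rho>) + \<rho> * real (b - k)" if "k \<in> ?A" for k
    using bounded_increments[of k "b + 1" "\<lambda>k. - p k" \<rho>] ramp that
    by (simp add: of_nat_diff algebra_simps)
  then have "mean ?A p \<le> mean ?A (\<lambda>k. (p (b + 1) + \<rho>) + \<rho> * real (b - k))"
    by (rule mean_mono)
  also have "\<dots> = p (b + 1) + \<rho> + \<rho> * ((real (card ?A) - 1) / 2)"
    unfolding mean_add mean_mult_left mean_const[OF A]
    using \<open>a \<le> b\<close> by (subst mean_distance_right) auto
  also have "p (b + 1) \<le> sum p {b + 1..c}"
    using \<open>b < c\<close> nonneg by (intro member_le_sum) auto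
  also have "sum p {b + 1..c} = mean {b + 1..c} p * real (card {b + 1..c})"
    using card_times_mean[of "{b + 1..c}" p] \<open>b < c\<close> by (simp add: mult.commute)
  finally show ?thesis
    by simp
qed

section \<open>Structure of the clustering\<close>

lemma valid_clusteringD:
  assumes "valid_clustering P"
  shows "(\<Union>r<nclusters P. cluster P r) = {..<horizon P}"
    and "disjoint_family_on (cluster P) {..<nclusters P}"
    and "r < nclusters P \<Longrightarrow> cluster P r \<noteq> {}"
    and "r < nclusters P \<Longrightarrow> cluster P r = {Min (cluster P r)..Max (cluster P r)}"
    and "r + 1 < nclusters P \<Longrightarrow> Min (cluster P (r + 1)) = Max (cluster P r) + 1"
    and "cluster P 0 = {0}"
  using assms unfolding valid_clustering_def by (elim conjE; simp only: simp_thms)+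

lemma cluster_subset_horizon:
  assumes "valid_clustering P" "r < nclusters P" "k \<in> cluster P r"
  shows "k < horizon P"
proof -
  have "k \<in> (\<Union>r<nclusters P. cluster P r)"
    using assms(2,3) by blast
  then show ?thesis
    unfolding valid_clusteringD(1)[OF assms(1)] by simp
qed

lemma cluster_interval:
  assumes "valid_clustering P" "r < nclusters P"
  obtains a b where "cluster P r = {a..b}" "a \<le> b" "b < horizon P"
    "Min (cluster P r) = a" "Max (cluster P r) = b"
proof -
  define a b where "a = Min (cluster P r)" and "b = Max (cluster P r)"
  have eq: "cluster P r = {a..b}"
    using valid_clusteringD(4)[OF assms] by (simp only: a_def b_def)
  then have "a \<le> b"
    using valid_clusteringD(3)[OF assms] by simp
  moreover have "b < horizon P"
    using cluster_subset_horizon[OF assms, of b] \<open>a \<le> b\<close> eq by simp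
  ultimately show ?thesis
    using that eq a_def b_def by metis
qed

lemma finite_cluster:
  assumes "valid_clustering P" "r < nclusters P"
  shows "finite (cluster P r)" "cluster P r \<noteq> {}"
proof -
  obtain a b where "cluster P r = {a..b}" "a \<le> b"
    using cluster_interval[OF assms] by metis
  then show "finite (cluster P r)" "cluster P r \<noteq> {}"
    by simp_all
qed

lemma next_cluster_interval:
  assumes "valid_clustering P" "r + 1 < nclusters P"
  obtains a b c where "cluster P r = {a..b}" "cluster P (r + 1) = {b + 1..c}"
    "a \<le> b" "b < c" "c < horizon P" "Min (cluster P r) = a" "Min (cluster P (r + 1)) = b + 1"
proof -
  have "r < nclusters P"
    using assms by simp
  then obtain a b where 1: "cluster P r = {a..b}" "a \<le> b"
    "Min (cluster P r) = a" "Max (cluster P r) = b"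
    using cluster_interval assms(1) by metis
  obtain a' c where 2: "cluster P (r + 1) = {a'..c}" "a' \<le> c" "c < horizon P"
    "Min (cluster P (r + 1)) = a'"
    using cluster_interval assms by metis
  have "a' = b + 1"
    using valid_clusteringD(5)[OF assms] 1(4) 2(4) by simp
  with 1 2 show ?thesis
    by (intro that[of a b c]) auto
qed

lemma sum_horizon:
  fixes f :: "nat \<Rightarrow> real"
  assumes "valid_clustering P"
  shows "(\<Sum>k<horizon P. f k) = (\<Sum>r<nclusters P. \<Sum>k\<in>cluster P r. f k)"
proof -
  have "(\<Sum>k<horizon P. f k) = sum f (\<Union>r<nclusters P. cluster P r)"
    by (simp only: valid_clusteringD(1)[OF assms])
  also have "\<dots> = (\<Sum>r<nclusters P. \<Sum>k\<in>cluster P r. f k)"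
    using finite_cluster(1)[OF assms] valid_clusteringD(2)[OF assms]
    by (intro sum.UNION_disjoint) (auto simp: disjoint_family_on_def)
  finally show ?thesis .
qed

section \<open>Feasibility of the aggregated solution\<close>

lemma aggregate_simps:
  "u_ns (aggregate P z) = u_ns z"
  "u_th (aggregate P z) = u_th z"
  "u_ch (aggregate P z) = u_ch z"
  "u_dis (aggregate P z) = u_dis z"
  "e_net (aggregate P z) w r = mean (cluster P r) (e_net z w)"
  "e_ns (aggregate P z) w r = mean (cluster P r) (e_ns z w)"
  "e_st (aggregate P z) n w r = e_st z n w (Min (cluster P r))"
  "p_th (aggregate P z) g w r = mean (cluster P r) (p_th z g w)"
  "p_ch (aggregate P z) n w r = mean (cluster P r) (p_ch z n w)"
  "p_dis (aggregate P z) n w r = mean (cluster P r) (p_dis z n w)"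
  by (simp_all add: aggregate_def)

lemma Min_cluster_less_horizon:
  assumes "valid_clustering P" "r < nclusters P"
  shows "Min (cluster P r) < horizon P"
  using assms finite_cluster[OF assms] cluster_subset_horizon Min_in by metis

lemma aggregate_nonneg:
  assumes "valid_clustering P" "nonneg_vars P (horizon P) z"
  shows "nonneg_vars P (nclusters P) (aggregate P z)"
  using assms cluster_subset_horizon[OF assms(1)] Min_cluster_less_horizon[OF assms(1)]
  unfolding nonneg_vars_def aggregate_simps
  by (auto intro!: sum_nonneg divide_nonneg_nonneg)

text \<open>The first cluster is a single step, so the mean over it is the value at this step.\<close>
lemma aggregate_nonanticipative:
  assumes "valid_clustering P" "nonanticipative P z"
  shows "nonanticipative P (aggregate P z)"
  using assms(2) unfolding nonanticipative_def aggregate_simps valid_clusteringD(6)[OF assms(1)]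
  by simp

lemma aggregate_energy_balance:
  assumes "valid_clustering P" "FS_feasible P z" "w \<in> scenarios P" "r < nclusters P"
  shows "e_net (aggregate P z) w r
      = (\<Sum>k\<in>cluster P r. (P_vres P w k * step_len P - demand P w k) / csize P r)
        + (\<Sum>g\<in>thermal P. p_th (aggregate P z) g w r * step_len P) + e_ns (aggregate P z) w r
        + (\<Sum>n\<in>storage P.
             (p_dis (aggregate P z) n w r - p_ch (aggregate P z) n w r) * step_len P)"
proof -
  let ?A = "cluster P r" and ?\<Delta> = "step_len P"
  have "e_net z w k = P_vres P w k * ?\<Delta> - demand P w k
          + (\<Sum>n\<in>storage P. (p_dis z n w k - p_ch z n w k) * ?\<Delta>)
          + (\<Sum>g\<in>thermal P. p_th z g w k * ?\<Delta>) + e_ns z w k" if "k \<in> ?A" for k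
    using assms cluster_subset_horizon[OF assms(1,4) that] unfolding FS_feasible_def by blast
  then have "mean ?A (e_net z w) = mean ?A (\<lambda>k. P_vres P w k * ?\<Delta> - demand P w k
          + (\<Sum>n\<in>storage P. (p_dis z n w k - p_ch z n w k) * ?\<Delta>)
          + (\<Sum>g\<in>thermal P. p_th z g w k * ?\<Delta>) + e_ns z w k)"
    by (intro sum.cong) auto
  then show ?thesis
    unfolding aggregate_simps mean_linear by simp
qed

lemma aggregate_storage_dynamics:
  assumes "valid_clustering P" "FS_feasible P z" "n \<in> storage P" "w \<in> scenarios P"
    and "r + 1 < nclusters P"
  shows "e_st (aggregate P z) n w (r + 1) = e_st (aggregate P z) n w r
      + csize P r * (eff_ch P n * p_ch (aggregate P z) n w r
                     - eff_dis P n * p_dis (aggregate P z) n w r) * step_len P"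
proof -
  obtain a b c where cl: "cluster P r = {a..b}" "a \<le> b" "b < c" "c < horizon P"
    "Min (cluster P r) = a" "Min (cluster P (r + 1)) = b + 1"
    using next_cluster_interval[OF assms(1,5)] by metis
  let ?d = "\<lambda>k. (eff_ch P n * p_ch z n w k - eff_dis P n * p_dis z n w k) * step_len P"
  have "e_st z n w (b + 1) = e_st z n w a + real (card {a..b}) * mean {a..b} ?d"
  proof (rule telescope_by_mean[OF \<open>a \<le> b\<close>])
    fix k assume "k \<in> {a..b}"
    then have "k + 1 < horizon P"
      using cl by simp
    then show "e_st z n w (k + 1) = e_st z n w k + ?d k"
      using assms unfolding FS_feasible_def by blast
  qed
  then show ?thesis
    unfolding aggregate_simps cl(5,6) unfolding cl(1) mean_linear by (simp only: mult.assoc)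
qed

lemma aggregate_ramp:
  assumes "valid_clustering P" "FS_feasible P z" "g \<in> thermal P" "w \<in> scenarios P"
    and "r + 1 < nclusters P"
  shows "p_th (aggregate P z) g w (r + 1) - p_th (aggregate P z) g w r * csize P r
           \<le> ramp P g + ramp P g * ((csize P (r + 1) - 1) / 2)" (is ?up)
    and "p_th (aggregate P z) g w r - p_th (aggregate P z) g w (r + 1) * csize P (r + 1)
           \<le> ramp P g + ramp P g * ((csize P r - 1) / 2)" (is ?down)
proof -
  obtain a b c where cl: "cluster P r = {a..b}" "cluster P (r + 1) = {b + 1..c}"
    "a \<le> b" "b < c" "c < horizon P"
    using next_cluster_interval[OF assms(1,5)] by metis
  have nonneg: "0 \<le> p_th z g w k" if "k < horizon P" for k
    using assms that unfolding FS_feasible_def nonneg_vars_def by blast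
  have ramp: "p_th z g w (k + 1) - p_th z g w k \<le> ramp P g"
    "p_th z g w k - p_th z g w (k + 1) \<le> ramp P g" if "k + 1 < horizon P" for k
    using assms that unfolding FS_feasible_def by blast+
  show ?up
    unfolding aggregate_simps cl(1,2) by (rule ramp_up_mean) (use cl nonneg ramp in auto)
  show ?down
    unfolding aggregate_simps cl(1,2) by (rule ramp_down_mean) (use cl nonneg ramp in auto)
qed

lemma aggregate_feasible:
  assumes "valid_params P" "FS_feasible P z"
  shows "AGG_feasible P (aggregate P z)"
proof -
  have cl: "valid_clustering P"
    using assms(1) unfolding valid_params_def by blast
  have bounds: "E_min P n \<le> e_st (aggregate P z) n w r \<and> e_st (aggregate P z) n w r \<le> E_max P n \<and>
        0 \<le> p_ch (aggregate P z) n w r \<and> p_ch (aggregate P z) n w r \<le> P_ch_max P n \<and>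
        0 \<le> p_dis (aggregate P z) n w r \<and> p_dis (aggregate P z) n w r \<le> P_dis_max P n"
    if "n \<in> storage P" "w \<in> scenarios P" "r < nclusters P" for n w r
  proof -
    have fs: "E_min P n \<le> e_st z n w k \<and> e_st z n w k \<le> E_max P n \<and>
        0 \<le> p_ch z n w k \<and> p_ch z n w k \<le> P_ch_max P n \<and>
        0 \<le> p_dis z n w k \<and> p_dis z n w k \<le> P_dis_max P n" if "k < horizon P" for k
      using assms(2) \<open>n \<in> storage P\<close> \<open>w \<in> scenarios P\<close> that unfolding FS_feasible_def by blast
    note A = finite_cluster[OF cl that(3)] and h = cluster_subset_horizon[OF cl that(3)]
    show ?thesis
      unfolding aggregate_simps
      using fs[OF Min_cluster_less_horizon[OF cl that(3)]] fs[OF h]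
      by (intro conjI le_mean[OF A] mean_le[OF A]) auto
  qed
  have thermal: "P_th_min P g \<le> p_th (aggregate P z) g w r \<and>
        p_th (aggregate P z) g w r \<le> P_th_max P g \<and>
        em_quad P g * csize P r * (p_th (aggregate P z) g w r)\<^sup>2
          - em_quad P g * (csize P r - 1) * (P_th_max P g)\<^sup>2
          + em_lin P g * p_th (aggregate P z) g w r \<le> em_limit P g"
    if "g \<in> thermal P" "w \<in> scenarios P" "r < nclusters P" for g w r
  proof -
    note A = finite_cluster[OF cl that(3)] and h = cluster_subset_horizon[OF cl that(3)]
    have fs: "P_th_min P g \<le> p_th z g w k \<and> p_th z g w k \<le> P_th_max P g \<and>
        em_quad P g * (p_th z g w k)\<^sup>2 + em_lin P g * p_th z g w k \<le> em_limit P g"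
      if "k \<in> cluster P r" for k
      using assms(2) \<open>g \<in> thermal P\<close> \<open>w \<in> scenarios P\<close> h[OF that]
      unfolding FS_feasible_def by blast
    have nonneg: "0 \<le> p_th z g w k" if "k \<in> cluster P r" for k
      using assms(2) \<open>g \<in> thermal P\<close> \<open>w \<in> scenarios P\<close> h[OF that]
      unfolding FS_feasible_def nonneg_vars_def by blast
    have "0 \<le> em_quad P g"
      using assms(1) that unfolding valid_params_def by blast
    then show ?thesis
      unfolding aggregate_simps
      using fs nonneg by (intro conjI le_mean[OF A] mean_le[OF A] emission_of_mean[OF A]) auto
  qed
  have init: "e_st (aggregate P z) n w 0 = E_init P n"
    if "n \<in> storage P" "w \<in> scenarios P" for n w
    using assms(2) that unfolding aggregate_simps valid_clusteringD(6)[OF cl] FS_feasible_def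
    by simp
  have na: "nonanticipative P (aggregate P z)" "nonneg_vars P (nclusters P) (aggregate P z)"
    using assms(2) aggregate_nonanticipative[OF cl] aggregate_nonneg[OF cl]
    unfolding FS_feasible_def by blast+
  \<comment> \<open>The instances of \<open>conjI\<close> split only between constraint groups, so that each goal matches one
    of the facts below.\<close>
  show ?thesis
    unfolding AGG_feasible_def
    by (intro conjI[of "Ball _ _"] conjI[of "nonanticipative _ _"] ballI allI impI)
      (use aggregate_energy_balance[OF cl assms(2)] aggregate_storage_dynamics[OF cl assms(2)]
         init bounds thermal aggregate_ramp[OF cl assms(2)] na in blast)+
qed

section \<open>Cost of the aggregated solution\<close>

lemma sum_horizon_mean:
  assumes "valid_clustering P"
  shows "(\<Sum>k<horizon P. f k) = (\<Sum>r<nclusters P. csize P r * mean (cluster P r) f)"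
  unfolding sum_horizon[OF assms]
  using finite_cluster[OF assms]
  by (intro sum.cong refl card_times_mean[symmetric]) simp_all

text \<open>
  Sold energy enters the cost with the negative price. As the sales are nonnegative, raising each
  price to the maximum of its cluster can only lower the cost.
\<close>
lemma aggregate_trading_cost:
  assumes cl: "valid_clustering P"
    and sales: "\<And>k. k < horizon P \<Longrightarrow> 0 \<le> e k"
  shows "(\<Sum>r<nclusters P. csize P r *
             (- (MAX k\<in>cluster P r. \<pi> k) * mean (cluster P r) e + c * mean (cluster P r) s))
           \<le> (\<Sum>k<horizon P. - \<pi> k * e k + c * s k)"
  unfolding sum_horizon_mean[OF cl]
proof (intro sum_mono mult_left_mono)
  fix r assume "r \<in> {..<nclusters P}"
  then have r: "r < nclusters P" by simp
  let ?A = "cluster P r" and ?m = "MAX k\<in>cluster P r. \<pi> k"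
  have "- ?m * e k + c * s k \<le> - \<pi> k * e k + c * s k" if "k \<in> ?A" for k
  proof -
    have "\<pi> k \<le> ?m"
      using finite_cluster[OF cl r] that by (intro Max_ge) auto
    then show ?thesis
      using sales[OF cluster_subset_horizon[OF cl r that]] by (simp add: mult_right_mono)
  qed
  then have "mean ?A (\<lambda>k. - ?m * e k + c * s k) \<le> mean ?A (\<lambda>k. - \<pi> k * e k + c * s k)"
    by (rule mean_mono)
  then show "- ?m * mean ?A e + c * mean ?A s \<le> mean ?A (\<lambda>k. - \<pi> k * e k + c * s k)"
    unfolding mean_add mean_mult_left .
qed simp

lemma sum_Min_cluster_le:
  fixes f :: "nat \<Rightarrow> real"
  assumes "valid_clustering P" "\<And>k. 0 \<le> f k"
  shows "(\<Sum>r<nclusters P. f (Min (cluster P r))) \<le> (\<Sum>k<horizon P. f k)"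
  unfolding sum_horizon[OF assms(1)]
  using assms(2) finite_cluster[OF assms(1)] by (intro sum_mono member_le_sum) auto

lemma aggregate_cost_le:
  assumes "valid_params P" "FS_feasible P z"
  shows "AGG_cost P (aggregate P z) \<le> FS_cost P z"
proof -
  have cl: "valid_clustering P" and prob: "\<And>w. w \<in> scenarios P \<Longrightarrow> 0 \<le> prob P w"
    and ref: "\<And>n. n \<in> storage P \<Longrightarrow> 0 \<le> C_ref P n"
    using assms(1) unfolding valid_params_def by blast+
  have sales: "0 \<le> e_net z w k" if "w \<in> scenarios P" "k < horizon P" for w k
    using assms(2) that unfolding FS_feasible_def nonneg_vars_def by blast
  show ?thesis
    unfolding AGG_cost_def FS_cost_def aggregate_simps
  proof (intro add_mono sum_mono mult_left_mono prob)
    fix w assume "w \<in> scenarios P"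
    then show "(\<Sum>r<nclusters P. csize P r *
           (- (MAX k\<in>cluster P r. price P w k) * mean (cluster P r) (e_net z w)
            + C_ns P * mean (cluster P r) (e_ns z w)))
        \<le> (\<Sum>k<horizon P. - price P w k * e_net z w k + C_ns P * e_ns z w k)"
      using sales by (intro aggregate_trading_cost[OF cl])
  next
    fix w g
    show "(\<Sum>r<nclusters P. csize P r * C_th P g * mean (cluster P r) (p_th z g w) * step_len P)
        \<le> (\<Sum>k<horizon P. C_th P g * p_th z g w k * step_len P)"
      unfolding sum_horizon_mean[OF cl] mean_linear by (simp only: mult.assoc order_refl)
  next
    fix w n
    show "(\<Sum>r<nclusters P. csize P r * (C_ch P n * mean (cluster P r) (p_ch z n w)
             + C_dis P n * mean (cluster P r) (p_dis z n w)) * step_len P)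
        \<le> (\<Sum>k<horizon P. (C_ch P n * p_ch z n w k + C_dis P n * p_dis z n w k) * step_len P)"
      unfolding sum_horizon_mean[OF cl] mean_linear by (simp only: mult.assoc order_refl)
  next
    fix w n assume "n \<in> storage P"
    then show "(\<Sum>r<nclusters P. C_ref P n * (e_st z n w (Min (cluster P r)) - E_ref P n)\<^sup>2)
        \<le> (\<Sum>k<horizon P. C_ref P n * (e_st z n w k - E_ref P n)\<^sup>2)"
      using ref by (intro sum_Min_cluster_le[OF cl]) simp
  qed
qed

theorem proposition1:
  fixes P :: "('n, 'g, 'w) params" and z :: "('n, 'g, 'w) vars"
  assumes "valid_params P"
    and "FS_feasible P z"
  shows "AGG_feasible P (aggregate P z) \<and> AGG_cost P (aggregate P z) \<le> FS_cost P z"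
  using aggregate_feasible[OF assms] aggregate_cost_le[OF assms] by blast

end
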